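(* Let $a:\mathbb{N}\to\mathbb{R}$ be a sequence such that $a(1)\ge 0$, $a(n)\ne 0$ for some $n\in\mathbb{N}$, and $a(n)=O(n^{\varepsilon})$ for every $\varepsilon>0$. Put $Z(s)=\sum_{n=1}^\infty a(n)n^{-s}$ for $s=\sigma+\mathrm{i}t$, $\sigma>1$, $t\in\mathbb{R}$. Then for $\sigma>1$, the function $$\mathcal{Z}_\sigma(t):=\frac{Z(\sigma+\mathrm{i}t)}{Z(\sigma)},\qquad t\in\mathbb{R},$$ is a characteristic function (of a probability distribution on $\mathbb{R}$) if and only if $a(n)\ge 0$ for all $n\in\mathbb{N}$.
   Context: The characteristic function of a probability distribution $\mu$ on $\mathbb{R}$ is $\widehat\mu(t)=\int_{\mathbb{R}}e^{\mathrm{i}tx}\mu(dx)$. The Dirichlet series $Z(s)$ converges absolutely for $\sigma>1$ under the stated growth hypothesis. Convention: if $Z(\sigma)=0$, then $\mathcal{Z}_\sigma$ is regarded as not being a characteristic function.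
   Formalization: Adds the hypothesis that a(n) > 0 for some n; without it the claim fails, e.g. for a(2) = -1 and a(n) = 0 otherwise, where the quotient is 2^{-it}, a characteristic function. Only sequences with a(n) ≤ 0 for all n are excluded, and the claim fails for each. *)

theory Defs
  imports "HOL-Probability.Probability" "HOL-Library.Landau_Symbols"
begin

text \<open>
  Arithmetic sequences are functions on \<^typ>\<open>nat\<close> of which only the values at positive
  arguments matter; the index is shifted by one so that the value at \<open>0\<close> is never used.

  A pitfall: the normalized series below is unchanged when \<open>a\<close> is replaced by \<open>- a\<close>.  So a
  nonzero sequence with \<open>a n \<le> 0\<close> throughout (e.g. \<open>a 2 = -1\<close> and all other values \<open>0\<close>, where
  the quotient is \<open>2 powr (- \<i> t)\<close>) also gives a characteristic function, and \<open>a 1 \<ge> 0\<close> does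
  not exclude it when \<open>a 1 = 0\<close>.  Hence characterising \<open>a \<ge> 0\<close> needs some value to be positive.
\<close>
definition dirichlet_series :: "(nat \<Rightarrow> real) \<Rightarrow> complex \<Rightarrow> complex" where
  "dirichlet_series a s =
     (\<Sum>n. complex_of_real (a (Suc n)) * of_nat (Suc n) powr (- s))"

definition is_characteristic_function :: "(real \<Rightarrow> complex) \<Rightarrow> bool" where
  "is_characteristic_function \<phi> \<longleftrightarrow> (\<exists>\<mu>. real_distribution \<mu> \<and> (\<forall>t. \<phi> t = char \<mu> t))"

definition normalized_dirichlet :: "(nat \<Rightarrow> real) \<Rightarrow> real \<Rightarrow> real \<Rightarrow> complex" where
  "normalized_dirichlet a \<sigma> t =
     dirichlet_series a (Complex \<sigma> t) / dirichlet_series a (complex_of_real \<sigma>)"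

end

theory Submission
  imports Defs "HOL-Real_Asymp.Real_Asymp"
begin

text \<open>
  Write \<open>b\<^sub>n = a(n) n powr (-\<sigma>)\<close> and \<open>x\<^sub>n = - ln n\<close>.  On the vertical line through \<open>\<sigma>\<close> the Dirichlet
  series is the absolutely convergent trigonometric series \<open>\<Sum> b\<^sub>n exp(\<i> t x\<^sub>n)\<close>, and its value
  at \<open>t = 0\<close> is the real number \<open>Z(\<sigma>) = \<Sum> b\<^sub>n\<close>.  So the normalized function is, formally, the
  Fourier transform of the signed measure that puts the weight \<open>c\<^sub>n = b\<^sub>n / Z(\<sigma>)\<close> at the point
  \<open>x\<^sub>n\<close>.

  If all \<open>a(n)\<close> are nonnegative, this signed measure is a probability measure, and it is the
  required distribution (\<open>ex_real_distribution_of_coefficients\<close>).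

  Conversely, suppose that \<open>\<mu>\<close> is a probability measure with this Fourier transform.  Then \<open>\<mu>\<close>
  and the signed measure assign the same integral to every trigonometric polynomial, and
  integrals of nonnegative functions against \<open>\<mu>\<close> are nonnegative.  Testing with Fejer
  kernels (\<open>integral_fejer_kernel\<close>), which are nonnegative trigonometric polynomials bounded
  by \<open>1\<close> that concentrate at a chosen point \<open>x\<^sub>m\<close>, isolates the weight \<open>c\<^sub>m\<close> in the limit; hence
  \<open>c\<^sub>m \<ge> 0\<close> (\<open>coefficient_nonneg_of_char\<close>).  This works with a single frequency \<open>h\<close>: a Fejer kernel
  in \<open>h (x - x\<^sub>m)\<close> is periodic, but for all but countably many \<open>h\<close> no other \<open>x\<^sub>n\<close> lies on the
  lattice of its maxima (\<open>ex_separating_frequency\<close>).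

  Nonnegativity of all quotients \<open>b\<^sub>n / Z(\<sigma>)\<close> says only that the \<open>b\<^sub>n\<close> share the sign of \<open>Z(\<sigma>)\<close>.
  One positive value of \<open>a\<close> makes this sign positive.
\<close>

text \<open>
  The classical Fejer kernel, divided by \<open>N\<close> so that its maximum is \<open>1\<close>.  The squared modulus
  shows that it is nonnegative; that it is a trigonometric polynomial is
  \<open>fejer_kernel_eq_sum\<close>.
\<close>

definition fejer_kernel :: "nat \<Rightarrow> real \<Rightarrow> real" where
  "fejer_kernel N u = (cmod (\<Sum>j<N. iexp (real j * u)))\<^sup>2 / (real N)\<^sup>2"

lemma fejer_kernel_nonneg: "0 \<le> fejer_kernel N u"
  by (simp add: fejer_kernel_def)

lemma fejer_kernel_le_1: "fejer_kernel N u \<le> 1"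
proof (cases "N = 0")
  case False
  have "cmod (\<Sum>j<N. iexp (real j * u)) \<le> (\<Sum>j<N. 1)"
    by (rule sum_norm_le) simp
  then have "(cmod (\<Sum>j<N. iexp (real j * u)))\<^sup>2 \<le> (real N)\<^sup>2"
    by (intro power_mono) simp_all
  with False show ?thesis
    by (simp add: fejer_kernel_def)
qed (simp add: fejer_kernel_def)

lemma fejer_kernel_0: "0 < N \<Longrightarrow> fejer_kernel N 0 = 1"
  by (simp add: fejer_kernel_def)

text \<open>
  Off its period lattice the geometric sum in the kernel stays bounded as \<open>N\<close> grows, while it
  is divided by \<open>N\<close>.
\<close>

lemma fejer_kernel_tendsto_0:
  assumes "iexp u \<noteq> 1"
  shows "(\<lambda>N. fejer_kernel N u) \<longlonglongrightarrow> 0"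
proof (rule tendsto_sandwich[OF always_eventually always_eventually tendsto_const])
  define C where "C = (2 / cmod (1 - iexp u))\<^sup>2"
  show "\<forall>N. 0 \<le> fejer_kernel N u"
    by (simp add: fejer_kernel_nonneg)
  show "\<forall>N. fejer_kernel N u \<le> C / (real N)\<^sup>2"
  proof
    fix N
    have "(\<Sum>j<N. iexp (real j * u)) = (\<Sum>j<N. iexp u ^ j)"
      by (simp add: exp_of_nat_mult[symmetric] algebra_simps)
    also have "\<dots> = (1 - iexp u ^ N) / (1 - iexp u)"
      using assms by (simp add: sum_gp_strict)
    finally have "cmod (\<Sum>j<N. iexp (real j * u)) = cmod (1 - iexp u ^ N) / cmod (1 - iexp u)"
      by (simp add: norm_divide)
    also have "\<dots> \<le> 2 / cmod (1 - iexp u)"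
      using norm_triangle_ineq4[of 1 "iexp u ^ N"]
      by (intro divide_right_mono) (simp_all add: norm_power)
    finally have "(cmod (\<Sum>j<N. iexp (real j * u)))\<^sup>2 \<le> C"
      unfolding C_def by (rule power_mono) simp
    then show "fejer_kernel N u \<le> C / (real N)\<^sup>2"
      unfolding fejer_kernel_def by (rule divide_right_mono) simp
  qed
  show "(\<lambda>N. C / (real N)\<^sup>2) \<longlonglongrightarrow> 0"
    by real_asymp
qed

lemma fejer_kernel_eq_sum:
  "complex_of_real (fejer_kernel N u) =
     (\<Sum>j<N. \<Sum>k<N. iexp ((real j - real k) * u)) / (of_nat N)\<^sup>2"
proof -
  have "complex_of_real ((cmod (\<Sum>j<N. iexp (real j * u)))\<^sup>2) =
      (\<Sum>j<N. iexp (real j * u)) * (\<Sum>k<N. iexp (- (real k * u)))"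
    by (simp only: complex_norm_square cnj_sum)
       (simp add: exp_cnj)
  also have "\<dots> = (\<Sum>j<N. \<Sum>k<N. iexp ((real j - real k) * u))"
    by (simp add: sum_product exp_add[symmetric] algebra_simps)
  finally show ?thesis
    by (simp add: fejer_kernel_def)
qed

text \<open>
  Each pair \<open>(n, k)\<close> with \<open>k\<close> an integer excludes the single value \<open>2 \<pi> k / d\<^sub>n\<close> of \<open>h\<close>, so that
  only countably many \<open>h\<close> fail.
\<close>

lemma ex_separating_frequency:
  fixes d :: "nat \<Rightarrow> real"
  shows "\<exists>h. \<forall>n. d n \<noteq> 0 \<longrightarrow> iexp (h * d n) \<noteq> 1"
proof -
  define B where "B = (\<Union>n. \<Union>k::int. {of_int (2 * k) * pi / d n})"
  have "countable B"
    unfolding B_def by simp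
  then obtain h where h: "h \<notin> B"
    using uncountable_UNIV_real by (metis UNIV_I countable_subset subsetI)
  have "iexp (h * d n) \<noteq> 1" if "d n \<noteq> 0" for n
  proof
    assume "iexp (h * d n) = 1"
    then obtain k :: int where "h * d n = of_int (2 * k) * pi"
      by (auto simp: exp_eq_1)
    then have "h = of_int (2 * k) * pi / d n"
      using that by (simp add: field_simps)
    with h show False
      unfolding B_def by blast
  qed
  then show ?thesis by blast
qed

text \<open>
  The hypothesis on \<open>\<mu>\<close> is the formula \<open>\<integral> f d\<mu> = \<Sum> c\<^sub>n f(x\<^sub>n)\<close> for the functions \<open>f(z) = exp(\<i> t z)\<close>.
  Linearity extends it to trigonometric polynomials, and in particular to Fejer kernels.
\<close>

lemma integral_fejer_kernel:
  fixes c x :: "nat \<Rightarrow> real"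
  assumes "real_distribution \<mu>"
    and c: "summable (\<lambda>n. \<bar>c n\<bar>)"
    and char: "\<And>t. char \<mu> t = (\<Sum>n. complex_of_real (c n) * iexp (t * x n))"
  shows "(LINT z|\<mu>. fejer_kernel N (h * (z - y))) = (\<Sum>n. c n * fejer_kernel N (h * (x n - y)))"
proof -
  interpret real_distribution \<mu> by fact
  \<comment> \<open>These exponentials span the kernels in \<open>h (u - y)\<close>; the shift by \<open>y\<close> is only a constant factor.\<close>
  define E where "E s u = iexp (s * (h * (u - y)))" for s u :: real
  have E_split: "E s u = iexp (- (s * h * y)) * iexp ((s * h) * u)" for s u
    by (simp add: E_def exp_add[symmetric] algebra_simps)
  have int: "integrable \<mu> (E s)" for s
    unfolding E_def by (rule integrable_iexp) auto
  have summ: "summable (\<lambda>n. complex_of_real (c n) * iexp (f n))" for f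
    by (rule summable_norm_cancel) (use c in \<open>simp add: norm_mult\<close>)
  have summE: "summable (\<lambda>n. complex_of_real (c n) * E s (x n))" for s
    unfolding E_def by (rule summ)
  have E: "(LINT z|\<mu>. E s z) = (\<Sum>n. complex_of_real (c n) * E s (x n))" for s
  proof -
    have "(LINT z|\<mu>. E s z) = iexp (- (s * h * y)) * char \<mu> (s * h)"
      unfolding E_split char_def by (rule integral_mult_right_zero)
    also have "\<dots> = (\<Sum>n. iexp (- (s * h * y)) * (complex_of_real (c n) * iexp ((s * h) * x n)))"
      unfolding char by (rule suminf_mult[symmetric]) (rule summ)
    finally show ?thesis
      unfolding E_split by (simp only: mult.left_commute)
  qed
  have K: "complex_of_real (fejer_kernel N (h * (u - y))) =
      (\<Sum>j<N. \<Sum>k<N. E (real j - real k) u) / (of_nat N)\<^sup>2" for u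
    unfolding E_def by (rule fejer_kernel_eq_sum)
  have "complex_of_real (LINT z|\<mu>. fejer_kernel N (h * (z - y))) =
      (LINT z|\<mu>. (\<Sum>j<N. \<Sum>k<N. E (real j - real k) z) / (of_nat N)\<^sup>2)"
    by (simp only: integral_complex_of_real[symmetric] K)
  also have "\<dots> = (\<Sum>j<N. \<Sum>k<N. LINT z|\<mu>. E (real j - real k) z) / (of_nat N)\<^sup>2"
    by (simp add: int)
  also have "\<dots> = (\<Sum>j<N. \<Sum>k<N. \<Sum>n. complex_of_real (c n) * E (real j - real k) (x n)) / (of_nat N)\<^sup>2"
    by (simp only: E)
  also have "\<dots> = (\<Sum>n. (\<Sum>j<N. \<Sum>k<N. complex_of_real (c n) * E (real j - real k) (x n)) / (of_nat N)\<^sup>2)"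
    by (simp add: suminf_sum suminf_divide summable_sum summE)
  also have "\<dots> = (\<Sum>n. complex_of_real (c n * fejer_kernel N (h * (x n - y))))"
    by (simp only: of_real_mult K sum_distrib_left times_divide_eq_right)
  also have "\<dots> = complex_of_real (\<Sum>n. c n * fejer_kernel N (h * (x n - y)))"
  proof (rule suminf_of_real[symmetric])
    show "summable (\<lambda>n. c n * fejer_kernel N (h * (x n - y)))"
      by (rule summable_comparison_test'[OF c, of 0])
         (simp add: abs_mult fejer_kernel_nonneg fejer_kernel_le_1 mult_left_le)
  qed
  finally show ?thesis
    by (simp only: of_real_eq_iff)
qed

text \<open>
  An absolutely convergent trigonometric series with distinct frequencies that is a
  characteristic function has nonnegative coefficients.  The formula of
  \<open>integral_fejer_kernel\<close>, centred at \<open>x\<^sub>m\<close>, has a nonnegative left-hand side for every \<open>N\<close>, and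
  its right-hand side tends to \<open>c\<^sub>m\<close> by dominated convergence (Tannery), as the kernels are
  bounded by \<open>1\<close> and vanish in the limit at every other \<open>x\<^sub>n\<close>.
\<close>

lemma coefficient_nonneg_of_char:
  fixes c x :: "nat \<Rightarrow> real"
  assumes \<mu>: "real_distribution \<mu>"
    and c: "summable (\<lambda>n. \<bar>c n\<bar>)"
    and inj: "inj x"
    and char: "\<And>t. char \<mu> t = (\<Sum>n. complex_of_real (c n) * iexp (t * x n))"
  shows "0 \<le> c m"
proof -
  obtain h where h: "\<And>n. x n - x m \<noteq> 0 \<Longrightarrow> iexp (h * (x n - x m)) \<noteq> 1"
    using ex_separating_frequency[of "\<lambda>n. x n - x m"] by auto
  define s where "s N = (\<Sum>n. c n * fejer_kernel N (h * (x n - x m)))" for N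
  have lim: "(\<lambda>N. c n * fejer_kernel N (h * (x n - x m))) \<longlonglongrightarrow> (if n = m then c m else 0)" for n
  proof (cases "n = m")
    case True
    then show ?thesis
      by (auto intro!: tendsto_eventually eventually_mono[OF eventually_gt_at_top[of 0]]
          simp: fejer_kernel_0)
  next
    case False
    then have "x n - x m \<noteq> 0"
      using inj by (simp add: inj_eq)
    then show ?thesis
      using False tendsto_mult_right_zero[OF fejer_kernel_tendsto_0[OF h]] by simp
  qed
  have "s \<longlonglongrightarrow> (\<Sum>n. if n = m then c m else 0)"
    unfolding s_def
    by (rule tannerys_theorem[where M = "\<lambda>n. \<bar>c n\<bar>", THEN conjunct2, THEN conjunct2])
       (use lim c in \<open>auto simp: abs_mult fejer_kernel_nonneg fejer_kernel_le_1 mult_left_le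
         intro!: always_eventually\<close>)
  then have "s \<longlonglongrightarrow> c m"
    using sums_unique[OF sums_single[of m "\<lambda>_. c m"]] by simp
  moreover have "0 \<le> s N" for N
    unfolding s_def integral_fejer_kernel[OF \<mu> c char, symmetric]
    by (rule integral_nonneg_AE) (simp add: fejer_kernel_nonneg)
  ultimately show ?thesis
    by (intro LIMSEQ_le_const[of s "c m" 0]) auto
qed

text \<open>
  The distribution is the law of \<open>x\<^sub>N\<close> for a random index \<open>N\<close> that equals \<open>n\<close> with probability
  \<open>c\<^sub>n\<close>.
\<close>

lemma ex_real_distribution_of_coefficients:
  fixes c x :: "nat \<Rightarrow> real"
  assumes nonneg: "\<And>n. 0 \<le> c n" and sums: "c sums 1"
  shows "\<exists>\<mu>. real_distribution \<mu> \<and> (\<forall>t. char \<mu> t = (\<Sum>n. complex_of_real (c n) * iexp (t * x n)))"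
proof -
  have "(\<integral>\<^sup>+ n. ennreal (c n) \<partial>count_space UNIV) = 1"
    using sums nonneg
    by (simp add: nn_integral_count_space_nat suminf_ennreal2 sums_iff)
  then have pmf: "pmf (embed_pmf c) n = c n" for n
    using nonneg by (intro pmf_embed_pmf)
  define \<mu> where "\<mu> = distr (measure_pmf (embed_pmf c)) borel x"
  have "real_distribution \<mu>"
    unfolding \<mu>_def by (intro prob_space.real_distribution_distr measure_pmf.prob_space_axioms) simp
  moreover have "char \<mu> t = (\<Sum>n. complex_of_real (c n) * iexp (t * x n))" for t
  proof -
    have "summable (\<lambda>n. norm (c n *\<^sub>R iexp (t * x n)))"
      using sums nonneg by (simp add: sums_iff)
    then have int: "integrable (count_space UNIV) (\<lambda>n. c n *\<^sub>R iexp (t * x n))"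
      by (simp only: integrable_count_space_nat_iff)
    have "char \<mu> t = (LINT n|measure_pmf (embed_pmf c). iexp (t * x n))"
      unfolding \<mu>_def char_def by (subst integral_distr) auto
    also have "\<dots> = (LINT n|count_space UNIV. c n *\<^sub>R iexp (t * x n))"
      unfolding measure_pmf_eq_density by (subst integral_density) (auto simp: pmf nonneg)
    also have "\<dots> = (\<Sum>n. complex_of_real (c n) * iexp (t * x n))"
      using integral_count_space_nat[OF int] by (simp add: scaleR_conv_of_real)
    finally show ?thesis .
  qed
  ultimately show ?thesis by blast
qed

text \<open>
  Half of the distance from \<open>\<sigma>\<close> to \<open>1\<close> is spent on the growth of \<open>a\<close>; the other half keeps the
  exponent of the majorant below \<open>-1\<close>.
\<close>

lemma summable_dirichlet_coefficients:
  fixes a :: "nat \<Rightarrow> real"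
  assumes growth: "\<forall>\<epsilon>>0. a \<in> O(\<lambda>n. real n powr \<epsilon>)" and sigma: "\<sigma> > 1"
  shows "summable (\<lambda>n. \<bar>a (Suc n) * real (Suc n) powr (- \<sigma>)\<bar>)"
proof -
  define \<epsilon> where "\<epsilon> = (\<sigma> - 1) / 2"
  have "\<epsilon> > 0" "\<epsilon> - \<sigma> < - 1"
    using sigma by (simp_all add: \<epsilon>_def field_simps)
  have "(\<lambda>n. a n * real n powr (- \<sigma>)) \<in> O(\<lambda>n. real n powr \<epsilon> * real n powr (- \<sigma>))"
    using growth \<open>\<epsilon> > 0\<close> by (intro landau_o.big.mult landau_o.big_refl) blast
  then have "(\<lambda>n. a n * real n powr (- \<sigma>)) \<in> O(\<lambda>n. real n powr (\<epsilon> - \<sigma>))"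
    by (simp only: powr_add[symmetric] diff_conv_add_uminus)
  then have "(\<lambda>n. \<bar>a n * real n powr (- \<sigma>)\<bar>) \<in> O(\<lambda>n. real n powr (\<epsilon> - \<sigma>))"
    by (simp only: landau_o.big.abs_in_iff)
  moreover have "summable (\<lambda>n. norm (real n powr (\<epsilon> - \<sigma>)))"
    using \<open>\<epsilon> - \<sigma> < - 1\<close> by (simp add: summable_real_powr_iff)
  ultimately have "summable (\<lambda>n. \<bar>a n * real n powr (- \<sigma>)\<bar>)"
    by (rule summable_comparison_test_bigo[rotated])
  then show ?thesis
    by (rule summable_Suc_iff[where f = "\<lambda>n. \<bar>a n * real n powr (- \<sigma>)\<bar>", THEN iffD2])
qed

lemma dirichlet_series_eq:
  "dirichlet_series a (Complex \<sigma> t) =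
     (\<Sum>n. complex_of_real (a (Suc n) * real (Suc n) powr (- \<sigma>)) * iexp (t * - ln (real (Suc n))))"
proof -
  have "(of_nat (Suc n) :: complex) powr (- Complex \<sigma> t) =
      complex_of_real (real (Suc n) powr (- \<sigma>)) * iexp (t * - ln (real (Suc n)))" for n
  proof -
    have ln: "Ln (of_nat (Suc n) :: complex) = complex_of_real (ln (real (Suc n)))"
      using Ln_of_real[of "real (Suc n)"] by simp
    have "(of_nat (Suc n) :: complex) powr (- Complex \<sigma> t) =
        exp (complex_of_real (- \<sigma> * ln (real (Suc n))) + \<i> * complex_of_real (t * - ln (real (Suc n))))"
      unfolding powr_def ln by (simp add: Complex_eq algebra_simps del: of_nat_Suc)
    then show ?thesis
      unfolding exp_add exp_of_real by (simp add: powr_def del: of_nat_Suc)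
  qed
  then show ?thesis
    unfolding dirichlet_series_def by (simp only: of_real_mult mult.assoc)
qed

theorem theorem1p5:
  fixes a :: "nat \<Rightarrow> real" and \<sigma> :: real
  assumes first_nonneg: "a 1 \<ge> 0"
    and nonzero: "\<exists>n\<ge>1. a n \<noteq> 0"
    and some_pos: "\<exists>n\<ge>1. a n > 0"
    and growth: "\<forall>\<epsilon>>0. a \<in> O(\<lambda>n. real n powr \<epsilon>)"
    and sigma: "\<sigma> > 1"
  shows "(dirichlet_series a (complex_of_real \<sigma>) \<noteq> 0 \<and>
            is_characteristic_function (normalized_dirichlet a \<sigma>))
         \<longleftrightarrow> (\<forall>n\<ge>1. a n \<ge> 0)"
proof -
  define b where "b n = a (Suc n) * real (Suc n) powr (- \<sigma>)" for n
  define x where "x n = - ln (real (Suc n))" for n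
  define Z where "Z = (\<Sum>n. b n)"
  have abs_b: "summable (\<lambda>n. \<bar>b n\<bar>)"
    unfolding b_def by (rule summable_dirichlet_coefficients[OF growth sigma])
  then have summ_b: "summable b"
    by (rule summable_rabs_cancel)
  have series: "dirichlet_series a (Complex \<sigma> t) = (\<Sum>n. complex_of_real (b n) * iexp (t * x n))" for t
    unfolding b_def x_def by (rule dirichlet_series_eq)
  have Z: "dirichlet_series a (complex_of_real \<sigma>) = complex_of_real Z"
    using series[of 0] suminf_of_real[OF summ_b, where 'a = complex]
    by (simp add: Z_def Complex_eq)
  have quotient: "normalized_dirichlet a \<sigma> t = (\<Sum>n. complex_of_real (b n / Z) * iexp (t * x n))" for t
  proof -
    have "summable (\<lambda>n. complex_of_real (b n) * iexp (t * x n))"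
      by (rule summable_norm_cancel) (use abs_b in \<open>simp add: norm_mult\<close>)
    from suminf_divide[OF this, of "complex_of_real Z"] show ?thesis
      by (simp add: normalized_dirichlet_def series Z)
  qed
  have b_nonneg_iff: "0 \<le> b n \<longleftrightarrow> 0 \<le> a (Suc n)" for n
    by (simp add: b_def zero_le_mult_iff)
  obtain p where p: "0 < b p"
  proof -
    obtain n where "n \<ge> 1" "0 < a n"
      using some_pos by blast
    then have "0 < b (n - 1)"
      by (simp add: b_def)
    then show ?thesis
      by (rule that)
  qed
  show ?thesis
  proof (intro iffI conjI)
    assume L: "dirichlet_series a (complex_of_real \<sigma>) \<noteq> 0 \<and>
      is_characteristic_function (normalized_dirichlet a \<sigma>)"
    then obtain \<mu> where \<mu>: "real_distribution \<mu>" "\<And>t. normalized_dirichlet a \<sigma> t = char \<mu> t"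
      unfolding is_characteristic_function_def by auto
    have "inj x"
      by (auto simp: x_def inj_def)
    have coeff: "0 \<le> b n / Z" for n
    proof (rule coefficient_nonneg_of_char[OF \<mu>(1) _ \<open>inj x\<close>])
      show "summable (\<lambda>n. \<bar>b n / Z\<bar>)"
        using abs_b by (simp add: abs_divide summable_divide)
      show "char \<mu> t = (\<Sum>n. complex_of_real (b n / Z) * iexp (t * x n))" for t
        by (simp only: \<mu>(2)[symmetric] quotient)
    qed
    \<comment> \<open>The quotient \<open>b p / Z\<close> is nonnegative with positive numerator, which fixes the sign of \<open>Z\<close>.\<close>
    have "Z > 0"
      using coeff[of p] p L Z by (auto simp: zero_le_divide_iff)
    with coeff have "0 \<le> a (Suc n)" for n
      by (simp add: zero_le_divide_iff b_nonneg_iff[symmetric])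
    then show "\<forall>n\<ge>1. 0 \<le> a n"
      by (simp add: Suc_le_eq gr0_conv_Suc) blast
  next
    assume "\<forall>n\<ge>1. 0 \<le> a n"
    then have b: "0 \<le> b n" for n
      by (simp add: b_nonneg_iff)
    have "0 < Z"
      unfolding Z_def using summ_b b p by (rule suminf_pos2)
    then show "dirichlet_series a (complex_of_real \<sigma>) \<noteq> 0"
      by (simp add: Z)
    have "b sums Z"
      unfolding Z_def using summ_b by (rule summable_sums)
    then have "(\<lambda>n. b n / Z) sums 1"
      using sums_divide[of b Z Z] \<open>0 < Z\<close> by simp
    then show "is_characteristic_function (normalized_dirichlet a \<sigma>)"
      using ex_real_distribution_of_coefficients[of "\<lambda>n. b n / Z" x] b \<open>0 < Z\<close>
      unfolding is_characteristic_function_def quotient by (metis divide_nonneg_pos)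
  qed
qed

end
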